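(* Let $p$ be an odd prime and let $x$ be an integer not divisible by $p$. For $n\ge 0$ define $$D_n(x)=\sum_{k=0}^{n}\binom{n}{k}\binom{n+k}{k}x^k,\qquad S_n(x)=\sum_{k=0}^{n}\binom{n}{k}\binom{n+k}{k}\frac{x^k}{k+1}.$$ Then $$\sum_{k=1}^{p-1}D_k(x)S_k(x)\equiv 0 \pmod{p}.$$
   Context: For rational numbers $a,b$ and a prime power $p^r$, $a\equiv b\pmod{p^r}$ means that $a-b=p^r c$ for some rational $c$ whose denominator is not divisible by $p$. *)

theory Defs
  imports "HOL-Number_Theory.Number_Theory"
begin

(* Congruence of rationals modulo the prime power p ^ r, meant for p prime.
   quotient_of returns the reduced fraction with positive denominator. *)
definition rat_cong :: "nat \<Rightarrow> nat \<Rightarrow> rat \<Rightarrow> rat \<Rightarrow> bool" where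
  "rat_cong p r a b \<longleftrightarrow>
     (\<exists>c. a - b = of_nat p ^ r * c \<and> \<not> int p dvd snd (quotient_of c))"

definition D :: "nat \<Rightarrow> int \<Rightarrow> rat" where
  "D n x = (\<Sum>k=0..n. of_nat (n choose k) * of_nat ((n + k) choose k) * of_int x ^ k)"

definition S :: "nat \<Rightarrow> int \<Rightarrow> rat" where
  "S n x = (\<Sum>k=0..n. of_nat (n choose k) * of_nat ((n + k) choose k)
              * (of_int x ^ k / of_nat (k + 1)))"

end

(* Put y = 2x + 1, z = x(x + 1), so that 1 + 4z = y^2 and D_n(x) is the Legendre polynomial P_n(y).
   The squares D_n^2, D_n S_n, S_n^2 expand, Clausen-style, in powers of z; since D_{n+1} and S_{n+1}
   are linear in D_n and S_n, the three expansions are proved by a simultaneous induction on n.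
   As C(n,k) C(n+k,k) k!^2 is the product of n(n+1) - j(j+1) over j < k, the coefficient of z^k in
   2 x D_n S_n / y is, up to a factor independent of n, a polynomial in n of degree 2k - 2, whose sum
   over a complete residue system mod p vanishes for 2k < p; for 2k > p that factor is divisible
   by p. What survives is the term n = 0, so the sum is y / (2x) times the sum of C(2k,k) (-z)^k
   over 1 <= k <= h = (p - 1)/2. Since C(2k,k) = (-4)^k C(h,k) mod p, this is
   y ((1 + 4z)^h - 1) / (2x) = (y^p - y) / (2x) = 0 mod p. *)

theory Submission
  imports Defs "HOL-Computational_Algebra.Polynomial"
begin

section \<open>Recurrences in n for the coefficients and for D_n, S_n\<close>

text \<open>Turns a recurrence between coefficients into one between polynomials: the part indexed
  by k instead of k + 1 acquires a factor w. The condition \<open>h m = 0\<close> discards the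
  overflow at the top, so that all sums keep the same range.\<close>

lemma sum_power_shift:
  fixes w :: "'a::comm_semiring_1"
  assumes "g 0 = f 0" and "\<And>k. g (Suc k) = f (Suc k) + h k" and "h m = 0"
  shows "(\<Sum>k\<le>m. g k * w ^ k) = (\<Sum>k\<le>m. f k * w ^ k) + w * (\<Sum>k\<le>m. h k * w ^ k)"
proof -
  have "(\<Sum>k\<le>m. g k * w ^ k) = (\<Sum>k\<le>m. f k * w ^ k) + w * (\<Sum>k<m. h k * w ^ k)"
    by (induction m) (simp_all add: assms(1,2) algebra_simps)
  also have "(\<Sum>k<m. h k * w ^ k) = (\<Sum>k\<le>m. h k * w ^ k)"
    by (simp add: lessThan_Suc_atMost[symmetric] assms(3))
  finally show ?thesis .
qed

text \<open>Rational-valued, so that the hypergeometric ratios below can be written with division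
  and untruncated subtraction.\<close>

definition delannoy :: "nat \<Rightarrow> nat \<Rightarrow> rat" where
  "delannoy n k = of_nat (n choose k) * of_nat ((n + k) choose k)"

lemma delannoy_0 [simp]: "delannoy n 0 = 1"
  by (simp add: delannoy_def)

lemma delannoy_eq_0: "n < k \<Longrightarrow> delannoy n k = 0"
  by (simp add: delannoy_def)

lemma delannoy_Suc:
  "delannoy n (Suc k) = (of_nat n + of_nat k + 1) * (of_nat n - of_nat k) / (of_nat k + 1) ^ 2 * delannoy n k"
proof -
  have "of_nat (Suc k * (n choose Suc k)) = (of_nat ((n - k) * (n choose k)) :: rat)"
    by (simp only: binomial_absorb_comp binomial_absorption)
  then have 1: "(of_nat k + 1) * of_nat (n choose Suc k) = (of_nat n - of_nat k) * (of_nat (n choose k) :: rat)"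
    \<comment> \<open>For k > n both binomials vanish, so the truncated \<open>n - k\<close> may be
      replaced by the rational difference.\<close>
    by (cases "k \<le> n") (simp_all add: of_nat_diff algebra_simps)
  have "of_nat (Suc k * (Suc (n + k) choose Suc k)) = (of_nat (Suc (n + k) * ((n + k) choose k)) :: rat)"
    by (simp only: Suc_times_binomial)
  then have 2: "(of_nat k + 1) * of_nat (Suc (n + k) choose Suc k) = (of_nat n + of_nat k + 1) * (of_nat ((n + k) choose k) :: rat)"
    by (simp add: algebra_simps del: binomial_Suc_Suc)
  have "(of_nat k + 1) ^ 2 * delannoy n (Suc k)
      = ((of_nat k + 1) * of_nat (n choose Suc k)) * ((of_nat k + 1) * of_nat (Suc (n + k) choose Suc k))"
    by (simp add: delannoy_def power2_eq_square del: binomial_Suc_Suc)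
  also have "\<dots> = (of_nat n + of_nat k + 1) * (of_nat n - of_nat k) * delannoy n k"
    unfolding 1 2 by (simp add: delannoy_def)
  finally show ?thesis
    using of_nat_neq_0[of k, where 'a = rat] by (simp add: field_simps)
qed

text \<open>With \<open>delannoy_Suc\<close>, this writes every coefficient occurring in the
  recurrences as a rational multiple of the one \<open>delannoy n k\<close>; each recurrence then
  reduces to an identity of rational functions in n and k.\<close>

lemma delannoy_Suc_Suc:
  "delannoy (Suc n) (Suc k) = (of_nat n + of_nat k + 2) * (of_nat n + of_nat k + 1) / (of_nat k + 1) ^ 2 * delannoy n k"
proof -
  have "of_nat (Suc k * (Suc n choose Suc k)) = (of_nat (Suc n * (n choose k)) :: rat)"
    by (simp only: Suc_times_binomial)
  then have 1: "(of_nat k + 1) * of_nat (Suc n choose Suc k) = (of_nat n + 1) * (of_nat (n choose k) :: rat)"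
    by (simp add: algebra_simps del: binomial_Suc_Suc)
  have "of_nat (Suc k * (Suc (Suc (n + k)) choose Suc k)) = (of_nat (Suc (Suc (n + k)) * (Suc (n + k) choose k)) :: rat)"
    by (simp only: Suc_times_binomial)
  then have 2: "(of_nat k + 1) * of_nat (Suc (Suc (n + k)) choose Suc k)
      = (of_nat n + of_nat k + 2) * (of_nat (Suc (n + k) choose k) :: rat)"
    by (simp add: algebra_simps del: binomial_Suc_Suc)
  have "of_nat ((Suc (n + k) - k) * (Suc (n + k) choose k)) = (of_nat (Suc (n + k) * ((n + k) choose k)) :: rat)"
    by (simp only: binomial_absorb_comp diff_Suc_1)
  then have 3: "(of_nat n + 1) * of_nat (Suc (n + k) choose k) = (of_nat n + of_nat k + 1) * (of_nat ((n + k) choose k) :: rat)"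
    by (simp add: algebra_simps Suc_diff_le del: binomial_Suc_Suc)
  have "(of_nat k + 1) ^ 2 * delannoy (Suc n) (Suc k)
      = ((of_nat k + 1) * of_nat (Suc n choose Suc k)) * ((of_nat k + 1) * of_nat (Suc (Suc (n + k)) choose Suc k))"
    by (simp add: delannoy_def power2_eq_square del: binomial_Suc_Suc)
  also have "\<dots> = (of_nat n + of_nat k + 2) * of_nat (n choose k) * ((of_nat n + 1) * of_nat (Suc (n + k) choose k))"
    unfolding 1 2 by simp
  also have "\<dots> = (of_nat n + of_nat k + 2) * (of_nat n + of_nat k + 1) * delannoy n k"
    unfolding 3 by (simp add: delannoy_def)
  finally show ?thesis
    using of_nat_neq_0[of k, where 'a = rat] by (simp add: field_simps)
qed

text \<open>The upper limit is left free so that the polynomials for n and for \<open>Suc n\<close>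
  can share one range.\<close>

lemma D_altdef: "n \<le> m \<Longrightarrow> D n x = (\<Sum>k\<le>m. delannoy n k * of_int x ^ k)"
  unfolding D_def atLeast0AtMost delannoy_def
  by (intro sum.mono_neutral_left) auto

lemma S_altdef: "n \<le> m \<Longrightarrow> S n x = (\<Sum>k\<le>m. delannoy n k / of_nat (Suc k) * of_int x ^ k)"
  unfolding S_def atLeast0AtMost delannoy_def
  by (intro sum.mono_neutral_cong_left) auto

text \<open>As x S_n is the integral of D_n from 0 to x, Legendre's equation gives 2 n (n + 1) x S_n
  = (y^2 - 1) P_n'(y) with y = 2x + 1. The claim is thus the classical (n + 1) (P_{n+1} - y P_n) =
  (y^2 - 1) P_n'(y); the proof compares coefficients of powers of x instead.\<close>

lemma D_Suc: "D (Suc n) x = (2 * of_int x + 1) * D n x + 2 * of_nat n * (of_int x * S n x)"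
proof -
  have "D (Suc n) x = (\<Sum>k\<le>Suc n. delannoy n k * of_int x ^ k)
      + of_int x * (\<Sum>k\<le>Suc n. (2 * delannoy n k + 2 * of_nat n * (delannoy n k / of_nat (Suc k))) * of_int x ^ k)"
    unfolding D_altdef[OF order_refl]
  proof (rule sum_power_shift)
    show "delannoy (Suc n) (Suc k) = delannoy n (Suc k)
        + (2 * delannoy n k + 2 * of_nat n * (delannoy n k / of_nat (Suc k)))" for k
      unfolding delannoy_Suc[of n] delannoy_Suc_Suc
      using of_nat_neq_0[of k, where 'a = rat] by (simp add: divide_simps) (simp add: algebra_simps power2_eq_square power3_eq_cube)
  qed (simp_all add: delannoy_eq_0)
  also have "\<dots> = (2 * of_int x + 1) * D n x + 2 * of_nat n * (of_int x * S n x)"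
    unfolding D_altdef[OF le_SucI[OF order_refl[of n]]] S_altdef[OF le_SucI[OF order_refl[of n]]]
    by (simp only: distrib_right[of _ _ "_ ^ _"] sum.distrib mult.assoc sum_distrib_left[symmetric])
      (simp add: algebra_simps del: sum.atMost_Suc)
  finally show ?thesis .
qed

lemma S_Suc:
  "(of_nat n + 2) * S (Suc n) x = 2 * (of_int x + 1) * D n x + (2 * of_int x + 1) * of_nat n * S n x"
proof -
  have "(of_nat n + 2) * S (Suc n) x = (\<Sum>k\<le>Suc n. (of_nat n + 2) * (delannoy (Suc n) k / of_nat (Suc k)) * of_int x ^ k)"
    unfolding S_altdef[OF order_refl] sum_distrib_left by (simp add: mult.assoc)
  also have "\<dots> = (\<Sum>k\<le>Suc n. (2 * delannoy n k + of_nat n * (delannoy n k / of_nat (Suc k))) * of_int x ^ k)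
      + of_int x * (\<Sum>k\<le>Suc n. (2 * delannoy n k + 2 * of_nat n * (delannoy n k / of_nat (Suc k))) * of_int x ^ k)"
  proof (rule sum_power_shift)
    have nz: "rat_of_nat k + 1 \<noteq> 0" "rat_of_nat k + 2 \<noteq> 0" for k
      using of_nat_neq_0[of k, where 'a = rat] of_nat_neq_0[of "Suc k", where 'a = rat] by (simp_all add: algebra_simps)
    show "(of_nat n + 2) * (delannoy (Suc n) (Suc k) / of_nat (Suc (Suc k)))
        = 2 * delannoy n (Suc k) + of_nat n * (delannoy n (Suc k) / of_nat (Suc (Suc k)))
        + (2 * delannoy n k + 2 * of_nat n * (delannoy n k / of_nat (Suc k)))" for k
      unfolding delannoy_Suc[of n] delannoy_Suc_Suc
      using nz[of k] by (simp add: divide_simps) (simp add: algebra_simps power2_eq_square power3_eq_cube)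
  qed (simp_all add: delannoy_eq_0)
  also have "\<dots> = 2 * (of_int x + 1) * D n x + (2 * of_int x + 1) * of_nat n * S n x"
    unfolding D_altdef[OF le_SucI[OF order_refl[of n]]] S_altdef[OF le_SucI[OF order_refl[of n]]]
    by (simp only: distrib_right[of _ _ "_ ^ _"] sum.distrib mult.assoc sum_distrib_left[symmetric])
      (simp add: algebra_simps del: sum.atMost_Suc)
  finally show ?thesis .
qed

section \<open>Clausen-type expansions of the quadratic products\<close>

text \<open>The coefficients of 3F2(-n, n + 1, 1/2; 1, 1; -4z) as a polynomial in z.\<close>

definition clausen :: "nat \<Rightarrow> nat \<Rightarrow> rat" where
  "clausen n k = delannoy n k * of_nat ((2 * k) choose k)"

lemma clausen_0 [simp]: "clausen n 0 = 1"
  by (simp add: clausen_def)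

lemma clausen_eq_0: "n < k \<Longrightarrow> clausen n k = 0"
  by (simp add: clausen_def delannoy_eq_0)

lemma central_binomial_Suc:
  "Suc k * ((2 * Suc k) choose Suc k) = 2 * (2 * k + 1) * ((2 * k) choose k)"
proof -
  \<comment> \<open>The spare factor \<open>Suc k\<close> allows two absorption steps without
    division; it is cancelled at the end.\<close>
  have "Suc k * (Suc k * ((2 * Suc k) choose Suc k)) = Suc k * (Suc (Suc (2 * k)) * (Suc (2 * k) choose k))"
    using Suc_times_binomial[of k "Suc (2 * k)"] by (simp del: binomial_Suc_Suc)
  also have "\<dots> = Suc (Suc (2 * k)) * ((Suc (2 * k) - k) * (Suc (2 * k) choose k))"
    by (simp add: Suc_diff_le del: binomial_Suc_Suc)
  also have "\<dots> = Suc (Suc (2 * k)) * (Suc (2 * k) * ((2 * k) choose k))"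
    by (simp only: binomial_absorb_comp diff_Suc_1)
  also have "\<dots> = Suc k * (2 * (2 * k + 1) * ((2 * k) choose k))"
    by (simp add: algebra_simps)
  finally show ?thesis
    using mult_cancel1[of "Suc k"] by blast
qed

lemma central_binomial_Suc_rat:
  "rat_of_nat ((2 * Suc k) choose Suc k) = 2 * (2 * of_nat k + 1) / (of_nat k + 1) * of_nat ((2 * k) choose k)"
proof -
  have "rat_of_nat (Suc k * ((2 * Suc k) choose Suc k)) = of_nat (2 * (2 * k + 1) * ((2 * k) choose k))"
    by (simp only: central_binomial_Suc)
  then have "(of_nat k + 1) * rat_of_nat ((2 * Suc k) choose Suc k) = 2 * (2 * of_nat k + 1) * of_nat ((2 * k) choose k)"
    by (simp only: of_nat_mult of_nat_Suc of_nat_add of_nat_1 of_nat_numeral add.commute)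
  then show ?thesis
    using of_nat_neq_0[of k, where 'a = rat] by (simp add: field_simps)
qed

lemma clausen_Suc:
  "clausen n (Suc k) = 2 * (2 * of_nat k + 1) * (of_nat n + of_nat k + 1) * (of_nat n - of_nat k) / (of_nat k + 1) ^ 3 * clausen n k"
  unfolding clausen_def delannoy_Suc central_binomial_Suc_rat by (simp add: power3_eq_cube power2_eq_square)

lemma clausen_Suc_Suc:
  "clausen (Suc n) (Suc k) = 2 * (2 * of_nat k + 1) * (of_nat n + of_nat k + 2) * (of_nat n + of_nat k + 1) / (of_nat k + 1) ^ 3 * clausen n k"
  unfolding clausen_def delannoy_Suc_Suc central_binomial_Suc_rat by (simp add: power3_eq_cube power2_eq_square)

context
  fixes m n :: nat and z :: rat
  assumes nm: "n < m"
begin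

text \<open>The sums with weights 1, k and k / (k + 1) form a closed linear system under n -> n + 1.
  In all three recurrences the shifted part is the same: it equals (k + 1) times
  \<open>clausen (Suc n) (Suc k) - clausen n (Suc k)\<close>. The bound n < m makes it vanish at k =
  m.\<close>

lemma clausen_sum_Suc:
  "(of_nat n + 1) * (\<Sum>k\<le>m. clausen (Suc n) k * z ^ k)
    = (of_nat n + 1) * (1 + 4 * z) * (\<Sum>k\<le>m. clausen n k * z ^ k)
      + 2 * (1 + 4 * z) * (\<Sum>k\<le>m. of_nat k * clausen n k * z ^ k)
      + 4 * of_nat n * z * (\<Sum>k\<le>m. of_nat k / of_nat (Suc k) * clausen n k * z ^ k)"
proof -
  have "(of_nat n + 1) * (\<Sum>k\<le>m. clausen (Suc n) k * z ^ k)
      = (\<Sum>k\<le>m. (of_nat n + 1) * clausen (Suc n) k * z ^ k)"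
    unfolding sum_distrib_left by (simp add: mult.assoc)
  also have "\<dots> = (\<Sum>k\<le>m. ((of_nat n + 1) * clausen n k + 2 * (of_nat k * clausen n k)) * z ^ k)
      + z * (\<Sum>k\<le>m. (4 * (of_nat n + 1) * clausen n k + 8 * (of_nat k * clausen n k)
          + 4 * of_nat n * (of_nat k / of_nat (Suc k) * clausen n k)) * z ^ k)"
  proof (rule sum_power_shift)
    show "(of_nat n + 1) * clausen (Suc n) (Suc k)
      = (of_nat n + 1) * clausen n (Suc k) + 2 * (of_nat (Suc k) * clausen n (Suc k))
        + (4 * (of_nat n + 1) * clausen n k + 8 * (of_nat k * clausen n k)
          + 4 * of_nat n * (of_nat k / of_nat (Suc k) * clausen n k))" for k
      unfolding clausen_Suc[of n] clausen_Suc_Suc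
      using of_nat_neq_0[of k, where 'a = rat] by (simp add: divide_simps) (simp add: algebra_simps power2_eq_square power3_eq_cube)
  qed (simp_all add: clausen_eq_0 nm)
  also have "\<dots> = (of_nat n + 1) * (1 + 4 * z) * (\<Sum>k\<le>m. clausen n k * z ^ k)
      + 2 * (1 + 4 * z) * (\<Sum>k\<le>m. of_nat k * clausen n k * z ^ k)
      + 4 * of_nat n * z * (\<Sum>k\<le>m. of_nat k / of_nat (Suc k) * clausen n k * z ^ k)"
    by (simp only: distrib_right[of _ _ "_ ^ _"] sum.distrib mult.assoc sum_distrib_left[symmetric])
      (simp add: algebra_simps)
  finally show ?thesis .
qed

lemma clausen_moment_sum_Suc:
  "(\<Sum>k\<le>m. of_nat k * clausen (Suc n) k * z ^ k)
    = 4 * (of_nat n + 1) * z * (\<Sum>k\<le>m. clausen n k * z ^ k)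
      + (1 + 8 * z) * (\<Sum>k\<le>m. of_nat k * clausen n k * z ^ k)
      + 4 * of_nat n * z * (\<Sum>k\<le>m. of_nat k / of_nat (Suc k) * clausen n k * z ^ k)"
proof -
  have "(\<Sum>k\<le>m. of_nat k * clausen (Suc n) k * z ^ k)
     = (\<Sum>k\<le>m. (of_nat k * clausen n k) * z ^ k)
      + z * (\<Sum>k\<le>m. (4 * (of_nat n + 1) * clausen n k + 8 * (of_nat k * clausen n k)
          + 4 * of_nat n * (of_nat k / of_nat (Suc k) * clausen n k)) * z ^ k)"
  proof (rule sum_power_shift)
    show "of_nat (Suc k) * clausen (Suc n) (Suc k)
      = of_nat (Suc k) * clausen n (Suc k)
        + (4 * (of_nat n + 1) * clausen n k + 8 * (of_nat k * clausen n k)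
          + 4 * of_nat n * (of_nat k / of_nat (Suc k) * clausen n k))" for k
      unfolding clausen_Suc[of n] clausen_Suc_Suc
      using of_nat_neq_0[of k, where 'a = rat] by (simp add: divide_simps) (simp add: algebra_simps power2_eq_square power3_eq_cube)
  qed (simp_all add: clausen_eq_0 nm)
  also have "\<dots> = 4 * (of_nat n + 1) * z * (\<Sum>k\<le>m. clausen n k * z ^ k)
      + (1 + 8 * z) * (\<Sum>k\<le>m. of_nat k * clausen n k * z ^ k)
      + 4 * of_nat n * z * (\<Sum>k\<le>m. of_nat k / of_nat (Suc k) * clausen n k * z ^ k)"
    by (simp only: distrib_right[of _ _ "_ ^ _"] sum.distrib mult.assoc sum_distrib_left[symmetric])
      (simp add: algebra_simps)
  finally show ?thesis .
qed

lemma clausen_ratio_sum_Suc: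
  "(of_nat n + 2) * (\<Sum>k\<le>m. of_nat k / of_nat (Suc k) * clausen (Suc n) k * z ^ k)
    = 4 * (of_nat n + 1) * z * (\<Sum>k\<le>m. clausen n k * z ^ k)
      + 2 * (1 + 4 * z) * (\<Sum>k\<le>m. of_nat k * clausen n k * z ^ k)
      + (1 + 4 * z) * of_nat n * (\<Sum>k\<le>m. of_nat k / of_nat (Suc k) * clausen n k * z ^ k)"
proof -
  have "(of_nat n + 2) * (\<Sum>k\<le>m. of_nat k / of_nat (Suc k) * clausen (Suc n) k * z ^ k)
      = (\<Sum>k\<le>m. (of_nat n + 2) * (of_nat k / of_nat (Suc k) * clausen (Suc n) k) * z ^ k)"
    unfolding sum_distrib_left by (simp add: mult.assoc)
  also have "\<dots> = (\<Sum>k\<le>m. (2 * (of_nat k * clausen n k) + of_nat n * (of_nat k / of_nat (Suc k) * clausen n k)) * z ^ k)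
      + z * (\<Sum>k\<le>m. (4 * (of_nat n + 1) * clausen n k + 8 * (of_nat k * clausen n k)
          + 4 * of_nat n * (of_nat k / of_nat (Suc k) * clausen n k)) * z ^ k)"
  proof (rule sum_power_shift)
    have nz: "rat_of_nat k + 1 \<noteq> 0" "rat_of_nat k + 2 \<noteq> 0" for k
      using of_nat_neq_0[of k, where 'a = rat] of_nat_neq_0[of "Suc k", where 'a = rat] by (simp_all add: algebra_simps)
    show "(of_nat n + 2) * (of_nat (Suc k) / of_nat (Suc (Suc k)) * clausen (Suc n) (Suc k))
      = 2 * (of_nat (Suc k) * clausen n (Suc k)) + of_nat n * (of_nat (Suc k) / of_nat (Suc (Suc k)) * clausen n (Suc k))
        + (4 * (of_nat n + 1) * clausen n k + 8 * (of_nat k * clausen n k)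
          + 4 * of_nat n * (of_nat k / of_nat (Suc k) * clausen n k))" for k
      unfolding clausen_Suc[of n] clausen_Suc_Suc
      using nz[of k] by (simp add: divide_simps) (simp add: algebra_simps power2_eq_square power3_eq_cube)
  qed (simp_all add: clausen_eq_0 nm)
  also have "\<dots> = 4 * (of_nat n + 1) * z * (\<Sum>k\<le>m. clausen n k * z ^ k)
      + 2 * (1 + 4 * z) * (\<Sum>k\<le>m. of_nat k * clausen n k * z ^ k)
      + (1 + 4 * z) * of_nat n * (\<Sum>k\<le>m. of_nat k / of_nat (Suc k) * clausen n k * z ^ k)"
    by (simp only: distrib_right[of _ _ "_ ^ _"] sum.distrib mult.assoc sum_distrib_left[symmetric])
      (simp add: algebra_simps)
  finally show ?thesis .
qed

end

text \<open>Expanding D_{n+1} and E_{n+1} by their recurrences, the quantities D^2, 2 n (n + 1) D E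
  and n (n + 1) E^2 obey the same linear system as the sums A, y B and z C, because y^2 = 1 + 4z.
  The mixed product is the one summed later; its recurrence involves both squares.\<close>

lemma clausen_products:
  fixes x :: int and n m :: nat
  defines "y \<equiv> 2 * of_int x + 1 :: rat" and "z \<equiv> of_int x * (of_int x + 1) :: rat"
    and "E \<equiv> \<lambda>n. of_int x * S n x"
  assumes "1 \<le> n" and "n \<le> m"
  shows "D n x ^ 2 = (\<Sum>k\<le>m. clausen n k * z ^ k)" (is "_ = ?A n")
    and "2 * of_nat n * (of_nat n + 1) * D n x * E n = y * (\<Sum>k\<le>m. of_nat k * clausen n k * z ^ k)" (is "_ = y * ?B n")
    and "of_nat n * (of_nat n + 1) * E n ^ 2 = z * (\<Sum>k\<le>m. of_nat k / of_nat (Suc k) * clausen n k * z ^ k)" (is "_ = z * ?C n")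
proof -
  have y2: "y ^ 2 = 1 + 4 * z"
    unfolding y_def z_def by (simp add: algebra_simps power2_eq_square)
  have "D n x ^ 2 = ?A n \<and> 2 * of_nat n * (of_nat n + 1) * D n x * E n = y * ?B n
      \<and> of_nat n * (of_nat n + 1) * E n ^ 2 = z * ?C n"
    using assms(4,5)
  proof (induction n rule: dec_induct)
    case base
    have restrict: "(\<Sum>k\<le>m. f k * clausen 1 k * z ^ k) = (\<Sum>k\<le>1. f k * clausen 1 k * z ^ k)" for f
      using base by (intro sum.mono_neutral_right) (auto simp: clausen_eq_0)
    have "clausen 1 1 = 4"
      by (simp add: clausen_def delannoy_def)
    moreover have "D 1 x = y" "E 1 = z"
      by (simp_all add: D_def S_def y_def z_def E_def algebra_simps)
    ultimately show ?case
      using restrict[of "\<lambda>_. 1"] restrict[of of_nat] restrict[of "\<lambda>k. of_nat k / of_nat (Suc k)"] y2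
      by (simp add: power2_eq_square)
  next
    case (step n)
    then have IH: "D n x ^ 2 = ?A n" "2 * of_nat n * (of_nat n + 1) * D n x * E n = y * ?B n"
      "of_nat n * (of_nat n + 1) * E n ^ 2 = z * ?C n" and nm: "n < m"
      by auto
    define N :: rat where "N = of_nat n"
    have nz: "N + 1 \<noteq> 0" "N + 2 \<noteq> 0"
      unfolding N_def using of_nat_neq_0[of n, where 'a = rat] of_nat_neq_0[of "Suc n", where 'a = rat]
      by (simp_all add: algebra_simps)
    have D: "D (Suc n) x = y * D n x + 2 * N * E n"
      unfolding D_Suc y_def E_def N_def by simp
    have "(N + 2) * E (Suc n) = of_int x * ((of_nat n + 2) * S (Suc n) x)"
      unfolding E_def N_def by simp
    also have "\<dots> = 2 * z * D n x + y * N * E n"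
      unfolding S_Suc y_def z_def E_def N_def by (simp add: algebra_simps)
    finally have E: "(N + 2) * E (Suc n) = 2 * z * D n x + y * N * E n" .
    note A = clausen_sum_Suc[OF nm, of z, folded N_def]
    note B = clausen_moment_sum_Suc[OF nm, of z, folded N_def]
    note C = clausen_ratio_sum_Suc[OF nm, of z, folded N_def]
    note IH = IH[folded N_def]
    have "(N + 1) * D (Suc n) x ^ 2
        = (N + 1) * y ^ 2 * D n x ^ 2 + 2 * y * (2 * N * (N + 1) * D n x * E n) + 4 * N * (N * (N + 1) * E n ^ 2)"
      unfolding D by (simp add: algebra_simps power2_eq_square)
    also have "\<dots> = (N + 1) * y ^ 2 * ?A n + 2 * y ^ 2 * ?B n + 4 * N * z * ?C n"
      unfolding IH by (simp add: power2_eq_square)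
    also have "\<dots> = (N + 1) * ?A (Suc n)"
      unfolding A y2 by simp
    finally have 1: "D (Suc n) x ^ 2 = ?A (Suc n)"
      using nz by simp
    have "2 * (N + 1) * (N + 2) * D (Suc n) x * E (Suc n)
        = 2 * (N + 1) * D (Suc n) x * ((N + 2) * E (Suc n))"
      by simp
    also have "\<dots> = 4 * (N + 1) * y * z * D n x ^ 2 + (y ^ 2 + 4 * z) * (2 * N * (N + 1) * D n x * E n)
        + 4 * N * y * (N * (N + 1) * E n ^ 2)"
      unfolding D E by (simp add: algebra_simps power2_eq_square)
    also have "\<dots> = y * ?B (Suc n)"
      unfolding B IH y2 by (simp add: algebra_simps)
    finally have 2: "2 * (N + 1) * (N + 2) * D (Suc n) x * E (Suc n) = y * ?B (Suc n)" .
    \<comment> \<open>Only (N + 2) E_{n+1} has a polynomial recurrence, so squaring leaves a spare N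
      + 2, cancelled afterwards.\<close>
    have "(N + 2) * ((N + 1) * (N + 2) * E (Suc n) ^ 2) = (N + 1) * ((N + 2) * E (Suc n)) ^ 2"
      by (simp add: power2_eq_square)
    also have "\<dots> = 4 * (N + 1) * z ^ 2 * D n x ^ 2 + 2 * y * z * (2 * N * (N + 1) * D n x * E n)
        + y ^ 2 * N * (N * (N + 1) * E n ^ 2)"
      unfolding E by (simp add: algebra_simps power2_eq_square)
    also have "\<dots> = 4 * (N + 1) * z ^ 2 * ?A n + 2 * z * y ^ 2 * ?B n + y ^ 2 * N * z * ?C n"
      unfolding IH by (simp add: power2_eq_square)
    also have "\<dots> = z * ((N + 2) * ?C (Suc n))"
      unfolding C y2 by (simp add: algebra_simps power2_eq_square)
    finally have 3: "(N + 1) * (N + 2) * E (Suc n) ^ 2 = z * ?C (Suc n)"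
      using nz by (simp add: mult.left_commute)
    from 1 2 3 show ?case
      by (simp add: N_def add.commute)
  qed
  then show "D n x ^ 2 = ?A n" "2 * of_nat n * (of_nat n + 1) * D n x * E n = y * ?B n"
    "of_nat n * (of_nat n + 1) * E n ^ 2 = z * ?C n"
    by blast+
qed

section \<open>The coefficients as polynomials in n\<close>

text \<open>The values at \<open>n\<close> are \<open>\<Prod>j=1..k. n (n + 1) - j (j + 1)\<close>.\<close>
definition oblong_diff_poly :: "nat \<Rightarrow> int poly" where
  "oblong_diff_poly k = (\<Prod>j<k. [:- ((int j + 1) * (int j + 2)), 1, 1:])"

text \<open>Each ratio contributes (n + j + 1) (n - j) = n (n + 1) - j (j + 1). The factor for j = 0
  is split off, since it cancels against the n (n + 1) in \<open>clausen_products\<close>; what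
  remains need not vanish at n = 0.\<close>

lemma delannoy_Suc_eq_oblong_diff_poly:
  "fact (Suc k) ^ 2 * delannoy n (Suc k)
    = of_nat n * (of_nat n + 1) * of_int (poly (oblong_diff_poly k) (int n))"
proof (induction k)
  case 0
  then show ?case by (simp add: delannoy_Suc oblong_diff_poly_def)
next
  case (Suc k)
  have fact: "fact (Suc (Suc k)) = (of_nat (Suc k) + 1) * (fact (Suc k) :: rat)"
    and nz: "rat_of_nat (Suc k) + 1 \<noteq> 0"
    using of_nat_neq_0[of "Suc k", where 'a = rat] by (simp_all add: algebra_simps)
  have "fact (Suc (Suc k)) ^ 2 * delannoy n (Suc (Suc k))
      = (of_nat n + of_nat (Suc k) + 1) * (of_nat n - of_nat (Suc k)) * (fact (Suc k) ^ 2 * delannoy n (Suc k))"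
    unfolding delannoy_Suc[of n "Suc k"] fact power_mult_distrib
    using nz by (simp del: fact_Suc of_nat_Suc)
  also have "\<dots> = of_nat n * (of_nat n + 1) * of_int (poly (oblong_diff_poly (Suc k)) (int n))"
    unfolding Suc.IH by (simp add: oblong_diff_poly_def algebra_simps)
  finally show ?case .
qed

lemma degree_oblong_diff_poly_le: "degree (oblong_diff_poly k) \<le> 2 * k"
proof -
  have "degree (oblong_diff_poly k) \<le> (\<Sum>j<k. 2)"
    unfolding oblong_diff_poly_def
    by (rule order_trans[OF degree_prod_sum_le]) (auto intro!: sum_mono)
  then show ?thesis by simp
qed

lemma poly_oblong_diff_poly_0: "poly (oblong_diff_poly k) 0 = (-1) ^ k * (fact k * fact (Suc k))"
  unfolding oblong_diff_poly_def by (induction k) (simp_all add: algebra_simps)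

section \<open>Power sums over a complete residue system\<close>

text \<open>The differences (n + 1)^(j+1) - n^(j+1) telescope to p^(j+1). Expanded binomially, they
  express (j + 1) times the j-th power sum through lower ones, and j + 1 < p is invertible modulo
  p.\<close>

lemma prime_dvd_sum_powers:
  assumes "prime p" and "j < p - 1"
  shows "int p dvd (\<Sum>n<p. int n ^ j)"
  using assms(2)
proof (induction j rule: less_induct)
  case (less j)
  have "int p ^ Suc j = (\<Sum>n<p. int (Suc n) ^ Suc j - int n ^ Suc j)"
    by (subst sum_lessThan_telescope) simp
  also have "\<dots> = (\<Sum>n<p. \<Sum>i\<le>j. of_nat (Suc j choose i) * int n ^ i)"
  proof (rule sum.cong[OF refl])
    fix n
    have "int (Suc n) ^ Suc j = (int n + 1) ^ Suc j"
      by (simp add: add.commute)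
    also have "\<dots> = (\<Sum>i\<le>j. of_nat (Suc j choose i) * int n ^ i) + int n ^ Suc j"
      by (subst binomial_ring) simp
    finally show "int (Suc n) ^ Suc j - int n ^ Suc j = (\<Sum>i\<le>j. of_nat (Suc j choose i) * int n ^ i)"
      by simp
  qed
  also have "\<dots> = (\<Sum>i\<le>j. of_nat (Suc j choose i) * (\<Sum>n<p. int n ^ i))"
    by (subst sum.swap) (simp add: sum_distrib_left)
  also have "\<dots> = (\<Sum>i<j. of_nat (Suc j choose i) * (\<Sum>n<p. int n ^ i)) + int (Suc j) * (\<Sum>n<p. int n ^ j)"
    by (simp add: lessThan_Suc_atMost[symmetric])
  finally have eq: "int (Suc j) * (\<Sum>n<p. int n ^ j)
      = int p ^ Suc j - (\<Sum>i<j. of_nat (Suc j choose i) * (\<Sum>n<p. int n ^ i))"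
    by simp
  have "int p dvd int (Suc j) * (\<Sum>n<p. int n ^ j)"
    unfolding eq 
  proof (intro dvd_diff)
    show "int p dvd (\<Sum>i<j. of_nat (Suc j choose i) * (\<Sum>n<p. int n ^ i))"
      using less by (intro dvd_sum[of "{..<j}"] dvd_mult) auto
  qed simp
  moreover have "\<not> int p dvd int (Suc j)"
    using less.prems by (auto dest!: dvd_imp_le simp del: of_nat_Suc)
  ultimately show ?case
    using assms(1) by (metis prime_dvd_mult_iff prime_nat_int_transfer)
qed

lemma prime_dvd_sum_poly:
  fixes f :: "int poly"
  assumes "prime p" and "degree f < p - 1"
  shows "int p dvd (\<Sum>n<p. poly f (int n))"
proof -
  have "(\<Sum>n<p. poly f (int n)) = (\<Sum>i\<le>degree f. coeff f i * (\<Sum>n<p. int n ^ i))"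
    unfolding poly_altdef by (subst sum.swap) (simp add: sum_distrib_left)
  also have "int p dvd \<dots>"
    using assms by (intro dvd_sum[of "{..degree f}"] dvd_mult prime_dvd_sum_powers) auto
  finally show ?thesis .
qed

section \<open>Central binomial coefficients modulo p\<close>

lemma prime_dvd_central_binomial:
  assumes "prime p" and "k < p" and "p \<le> 2 * k"
  shows "p dvd ((2 * k) choose k)"
proof -
  have "p dvd fact (2 * k)"
    using assms by (simp add: prime_dvd_fact_iff)
  also have "fact (2 * k) = fact k * fact k * ((2 * k) choose k)"
    using binomial_fact_lemma[of k "2 * k"] by simp
  finally show ?thesis
    using assms by (auto simp: prime_dvd_mult_iff prime_dvd_fact_iff)
qed

text \<open>Modulo p, h is -1/2, and C(2k,k) = (-4)^k C(-1/2,k). The induction compares successive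
  ratios, 2 (2k + 1) / (k + 1) against -4 (h - k) / (k + 1); k + 1 is invertible modulo p.\<close>

lemma central_binomial_cong:
  assumes "prime p" and "p = 2 * h + 1" and "k \<le> h"
  shows "[int ((2 * k) choose k) = (-4) ^ k * int (h choose k)] (mod int p)"
  using assms(3)
proof (induction k)
  case (Suc k)
  have cop: "coprime (int (Suc k)) (int p)"
  proof -
    have "\<not> p dvd Suc k"
      using Suc.prems assms(2) by (auto dest: dvd_imp_le)
    then have "coprime (Suc k) p"
      using assms(1) prime_imp_coprime coprime_commute by blast
    then show ?thesis
      by (simp only: coprime_int_iff)
  qed
  have 1: "int (Suc k) * int ((2 * Suc k) choose Suc k) = 2 * (2 * int k + 1) * int ((2 * k) choose k)"
    using arg_cong[OF central_binomial_Suc[of k], of int]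
    by (simp only: of_nat_mult of_nat_add of_nat_numeral of_nat_1)
  have "int (Suc k * (h choose Suc k)) = int ((h - k) * (h choose k))"
    by (simp only: binomial_absorb_comp binomial_absorption)
  then have 2: "int (Suc k) * int (h choose Suc k) = (int h - int k) * int (h choose k)"
    using Suc.prems by (simp only: of_nat_mult of_nat_diff Suc_leD)
  have "[2 * (2 * int k + 1) * int ((2 * k) choose k)
      = (-4 * (int h - int k)) * ((-4) ^ k * int (h choose k))] (mod int p)"
  proof (rule cong_mult)
    \<comment> \<open>The difference is 4h + 2, independent of k.\<close>
    have "2 * (2 * int k + 1) - -4 * (int h - int k) = 2 * int p"
      using assms(2) by simp
    then show "[2 * (2 * int k + 1) = -4 * (int h - int k)] (mod int p)"
      by (metis cong_iff_dvd_diff dvd_triv_right)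
  qed (use Suc in auto)
  also have "(-4 * (int h - int k)) * ((-4) ^ k * int (h choose k))
      = int (Suc k) * ((-4) ^ Suc k * int (h choose Suc k))"
    by (simp only: mult.left_commute[of "int (Suc k)"] 2) (simp only: power_Suc mult_ac)
  finally show ?case
    unfolding 1[symmetric] cong_mult_lcancel[OF cop] .
qed simp

lemma central_binomial_sum_cong:
  fixes z :: int
  assumes "prime p" and "p = 2 * h + 1"
  shows "[(\<Sum>k\<le>h. int ((2 * k) choose k) * (- z) ^ k) = (1 + 4 * z) ^ h] (mod int p)"
proof -
  have "[(\<Sum>k\<le>h. int ((2 * k) choose k) * (- z) ^ k)
      = (\<Sum>k\<le>h. (-4) ^ k * int (h choose k) * (- z) ^ k)] (mod int p)"
    using assms by (intro cong_sum cong_mult central_binomial_cong) auto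
  also have "(\<Sum>k\<le>h. (-4) ^ k * int (h choose k) * (- z) ^ k) = (4 * z + 1) ^ h"
  proof (subst binomial_ring, intro sum.cong refl)
    fix k
    have "(-4) ^ k * (- z) ^ k = (4 * z) ^ k"
      unfolding power_mult_distrib[symmetric] by simp
    then show "(-4) ^ k * int (h choose k) * (- z) ^ k = of_nat (h choose k) * (4 * z) ^ k * 1 ^ (h - k)"
      by (simp only: mult_ac power_one mult_1_right)
  qed
  finally show ?thesis by (simp add: add.commute)
qed

section \<open>Fermat's theorem for integers and a criterion for \<open>rat_cong\<close>\<close>

text \<open>The form y^p = y also covers multiples of p, which 2x + 1 may be. Otherwise y is
  replaced by its residue, a natural number, to apply \<open>fermat_theorem\<close>.\<close>

lemma fermat_int:
  fixes y :: int
  assumes "prime p"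
  shows "[y ^ p = y] (mod int p)"
proof (cases "int p dvd y")
  case True
  then show ?thesis
    using assms prime_gt_0_nat by (simp add: cong_iff_dvd_diff dvd_power_le dvd_diff dvd_trans[OF _ dvd_power])
next
  case False
  define r where "r = nat (y mod int p)"
  have r: "int r = y mod int p"
    unfolding r_def using prime_gt_0_nat[OF assms] by simp
  then have "\<not> p dvd r"
    using False by (metis dvd_mod_iff dvd_refl of_nat_dvd_iff)
  then have "[r ^ (p - 1) = 1] (mod p)"
    by (rule fermat_theorem[OF assms])
  then have "[int r ^ (p - 1) = 1] (mod int p)"
    by (metis cong_int_iff of_nat_1 of_nat_power)
  moreover have "[y = int r] (mod int p)"
    by (simp add: r)
  ultimately have "[y * y ^ (p - 1) = y * 1] (mod int p)"
    by (meson cong_mult cong_pow cong_refl cong_trans)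
  then show ?thesis
    using prime_gt_0_nat[OF assms] by (simp add: power_eq_if)
qed

text \<open>Any denominator d prime to p will do: the reduced denominator of j / d divides
  d.\<close>

lemma rat_cong_0I:
  assumes "q * of_int d = of_int (int p * j)" and "\<not> int p dvd d"
  shows "rat_cong p 1 q 0"
proof -
  define c :: rat where "c = of_int j / of_int d"
  have d: "d \<noteq> 0" using assms(2) by auto
  obtain a b where ab: "quotient_of c = (a, b)" by fastforce
  have "c = of_int a / of_int b" and b: "b > 0" and cop: "coprime a b"
    using quotient_of_div[OF ab] quotient_of_denom_pos[OF ab] quotient_of_coprime[OF ab] by auto
  then have "of_int (a * d) = (of_int (j * b) :: rat)"
    using d by (simp add: c_def field_simps)
  then have "b dvd a * d" by (simp only: of_int_eq_iff dvd_triv_right)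
  then have "b dvd d"
    using cop by (simp add: coprime_commute coprime_dvd_mult_right_iff)
  then have "\<not> int p dvd b" using assms(2) dvd_trans by blast
  moreover have "q - 0 = of_nat p ^ 1 * c"
    using assms(1) d by (simp add: c_def field_simps)
  ultimately show ?thesis
    unfolding rat_cong_def using ab by (metis snd_conv)
qed

section \<open>Clearing denominators and summing over n\<close>

text \<open>Multiplying by m!^2 clears all denominators for every n up to m at once, leaving
  integers that depend on n only through \<open>oblong_diff_poly\<close>. With m = p - 1 the
  multiplier is prime to p.\<close>

lemma D_mult_S:
  assumes "0 < n" and "n \<le> m"
  shows "2 * of_int x * (fact m ^ 2 * (D n x * S n x))
    = of_int ((2 * x + 1) * (\<Sum>k<m. int (Suc k) * int ((2 * Suc k) choose Suc k) * (fact m div fact (Suc k)) ^ 2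
        * (x * (x + 1)) ^ Suc k * poly (oblong_diff_poly k) (int n)))"
proof -
  define z :: rat where "z = of_int x * (of_int x + 1)"
  define N :: rat where "N = of_nat n * (of_nat n + 1)"
  have "N \<noteq> 0"
    unfolding N_def using assms(1) of_nat_neq_0[of n, where 'a = rat] by (simp add: add.commute)
  have "(fact (Suc k) :: int) dvd fact m" if "k < m" for k
    using that by (intro fact_dvd) simp
  then have fact: "(fact m :: rat) = of_int (fact m div fact (Suc k)) * fact (Suc k)" if "k < m" for k
    using that by (metis dvd_div_mult_self of_int_fact of_int_mult)
  have summand: "fact m ^ 2 * (of_nat (Suc k) * clausen n (Suc k) * z ^ Suc k)
      = N * of_int (int (Suc k) * int ((2 * Suc k) choose Suc k) * (fact m div fact (Suc k)) ^ 2
        * (x * (x + 1)) ^ Suc k * poly (oblong_diff_poly k) (int n))" if "k < m" for k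
  proof -
    have "fact m ^ 2 * (of_nat (Suc k) * clausen n (Suc k) * z ^ Suc k)
      = of_nat (Suc k) * of_nat ((2 * Suc k) choose Suc k) * of_int (fact m div fact (Suc k)) ^ 2 * z ^ Suc k
        * (fact (Suc k) ^ 2 * delannoy n (Suc k))"
      unfolding clausen_def fact[OF that] power_mult_distrib by (simp only: mult_ac)
    also have "\<dots> = N * of_int (int (Suc k) * int ((2 * Suc k) choose Suc k) * (fact m div fact (Suc k)) ^ 2
        * (x * (x + 1)) ^ Suc k * poly (oblong_diff_poly k) (int n))"
      unfolding delannoy_Suc_eq_oblong_diff_poly N_def z_def
      by (simp only: of_int_mult of_int_power of_int_of_nat_eq of_int_add of_int_1 mult_ac)
    finally show ?thesis .
  qed
  have "N * (2 * of_int x * (fact m ^ 2 * (D n x * S n x)))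
      = fact m ^ 2 * (2 * of_nat n * (of_nat n + 1) * D n x * (of_int x * S n x))"
    unfolding N_def by (simp only: mult_ac)
  also have "\<dots> = (2 * of_int x + 1) * (fact m ^ 2 * (\<Sum>k\<le>m. of_nat k * clausen n k * z ^ k))"
    using clausen_products(2)[of n m x] assms by (simp add: z_def)
  \<comment> \<open>The weight k removes the constant term, so from here index k stands for the
    power k + 1 of z.\<close>
  also have "(\<Sum>k\<le>m. of_nat k * clausen n k * z ^ k) = (\<Sum>k<m. of_nat (Suc k) * clausen n (Suc k) * z ^ Suc k)"
    by (simp only: lessThan_Suc_atMost[symmetric] sum.lessThan_Suc_shift of_nat_0 mult_zero_left add_0)
  also have "fact m ^ 2 * \<dots> = N * of_int (\<Sum>k<m. int (Suc k) * int ((2 * Suc k) choose Suc k) * (fact m div fact (Suc k)) ^ 2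
        * (x * (x + 1)) ^ Suc k * poly (oblong_diff_poly k) (int n))"
    unfolding of_int_sum sum_distrib_left by (intro sum.cong refl summand) simp
  finally show ?thesis
    using \<open>N \<noteq> 0\<close>
    by (simp only: of_int_mult of_int_add of_int_1 of_int_numeral mult.left_commute[of _ N] mult_cancel_left)
      simp
qed

text \<open>For k < h the degree is at most 2k < 2h = p - 1, so the sum over all residues vanishes
  and the sum from 1 is minus the value at 0. That value contains k! (k + 1)!, which the factor k +
  1 completes to (k + 1)!^2, restoring (p - 1)!^2. For k >= h, p <= 2 (k + 1) and k + 1 < p, so p
  divides the central binomial coefficient.\<close>

lemma oblong_diff_sum_cong:
  assumes "prime p" and "p = 2 * h + 1" and "k < p - 1"
  shows "[int (Suc k) * int ((2 * Suc k) choose Suc k) * (fact (p - 1) div fact (Suc k)) ^ 2 * z ^ Suc k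
        * (\<Sum>n=1..p-1. poly (oblong_diff_poly k) (int n))
      = (if k < h then fact (p - 1) ^ 2 * (int ((2 * Suc k) choose Suc k) * (- z) ^ Suc k) else 0)] (mod int p)"
proof (cases "k < h")
  case True
  have "int p dvd (\<Sum>n<p. poly (oblong_diff_poly k) (int n))"
    using True assms degree_oblong_diff_poly_le[of k] by (intro prime_dvd_sum_poly) auto
  also have "{..<p} = insert 0 {1..p-1}"
    using assms(2) by auto
  finally have "[(\<Sum>n=1..p-1. poly (oblong_diff_poly k) (int n)) = - poly (oblong_diff_poly k) 0] (mod int p)"
    by (simp add: cong_iff_dvd_diff add.commute)
  then have "[int (Suc k) * int ((2 * Suc k) choose Suc k) * (fact (p - 1) div fact (Suc k)) ^ 2 * z ^ Suc k
        * (\<Sum>n=1..p-1. poly (oblong_diff_poly k) (int n))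
     = int (Suc k) * int ((2 * Suc k) choose Suc k) * (fact (p - 1) div fact (Suc k)) ^ 2 * z ^ Suc k
        * - poly (oblong_diff_poly k) 0] (mod int p)"
    by (rule cong_scalar_left)
  also have "int (Suc k) * int ((2 * Suc k) choose Suc k) * (fact (p - 1) div fact (Suc k)) ^ 2 * z ^ Suc k
        * - poly (oblong_diff_poly k) 0
      = (fact (p - 1) div fact (Suc k) * fact (Suc k)) ^ 2 * (int ((2 * Suc k) choose Suc k) * (- z) ^ Suc k)"
    unfolding poly_oblong_diff_poly_0 power_minus[of z] fact_Suc[of k] power2_eq_square power_Suc[of "-1"] of_nat_id
    by (simp only: mult_ac mult_minus_left mult_minus_right mult_1_left mult_1_right)
  also have "fact (p - 1) div fact (Suc k) * fact (Suc k) = (fact (p - 1) :: int)"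
    using assms(3) by (intro dvd_div_mult_self fact_dvd) simp
  finally show ?thesis using True by simp
next
  case False
  have "p dvd ((2 * Suc k) choose Suc k)"
    using False assms by (intro prime_dvd_central_binomial) auto
  then have "int p dvd int ((2 * Suc k) choose Suc k)"
    by (simp only: of_nat_dvd_iff)
  with False show ?thesis
    by (simp only: cong_0_iff if_False dvd_mult2 dvd_mult)
qed

theorem theorem1p2:
  fixes p :: nat and x :: int
  assumes "prime p" and "odd p" and "\<not> int p dvd x"
  shows "rat_cong p 1 (\<Sum>k=1..p-1. D k x * S k x) 0"
proof -
  obtain h where h: "p = 2 * h + 1"
    using assms(2) by (elim oddE)
  define z where "z = x * (x + 1)"
  define c where "c = (\<lambda>k. int (Suc k) * int ((2 * Suc k) choose Suc k) * (fact (p - 1) div fact (Suc k)) ^ 2 * z ^ Suc k)"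
  \<comment> \<open>The integer numerator of the sum over the denominator 2 x (p - 1)!^2; it remains
    to show that p divides it.\<close>
  define R where "R = (2 * x + 1) * (\<Sum>k<p-1. c k * (\<Sum>n=1..p-1. poly (oblong_diff_poly k) (int n)))"
  have "2 * of_int x * fact (p - 1) ^ 2 * (\<Sum>n=1..p-1. D n x * S n x)
      = (\<Sum>n=1..p-1. 2 * of_int x * (fact (p - 1) ^ 2 * (D n x * S n x)))"
    by (simp only: sum_distrib_left mult.assoc)
  also have "\<dots> = (\<Sum>n=1..p-1. of_int ((2 * x + 1) * (\<Sum>k<p-1. c k * poly (oblong_diff_poly k) (int n))))"
    unfolding c_def z_def
    by (intro sum.cong refl D_mult_S) auto
  also have "\<dots> = of_int ((2 * x + 1) * (\<Sum>n=1..p-1. \<Sum>k<p-1. c k * poly (oblong_diff_poly k) (int n)))"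
    by (simp only: of_int_sum[symmetric] sum_distrib_left[symmetric])
  also have "(\<Sum>n=1..p-1. \<Sum>k<p-1. c k * poly (oblong_diff_poly k) (int n))
      = (\<Sum>k<p-1. c k * (\<Sum>n=1..p-1. poly (oblong_diff_poly k) (int n)))"
    by (subst sum.swap) (simp only: sum_distrib_left)
  finally have eq: "2 * of_int x * fact (p - 1) ^ 2 * (\<Sum>n=1..p-1. D n x * S n x) = of_int R"
    unfolding R_def .
  have "[(\<Sum>k<p-1. c k * (\<Sum>n=1..p-1. poly (oblong_diff_poly k) (int n)))
      = (\<Sum>k<p-1. if k < h then fact (p - 1) ^ 2 * (int ((2 * Suc k) choose Suc k) * (- z) ^ Suc k) else 0)] (mod int p)"
    unfolding c_def by (intro cong_sum oblong_diff_sum_cong[OF assms(1) h]) auto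
  also have "(\<Sum>k<p-1. if k < h then fact (p - 1) ^ 2 * (int ((2 * Suc k) choose Suc k) * (- z) ^ Suc k) else 0)
      = (\<Sum>k<h. fact (p - 1) ^ 2 * (int ((2 * Suc k) choose Suc k) * (- z) ^ Suc k))"
    using h by (intro sum.mono_neutral_cong_right) auto
  \<comment> \<open>The subtracted 1 is the term k = 0, absent from the shifted sum.\<close>
  also have "\<dots> = fact (p - 1) ^ 2 * ((\<Sum>k\<le>h. int ((2 * k) choose k) * (- z) ^ k) - 1)"
    unfolding sum_distrib_left[symmetric] lessThan_Suc_atMost[symmetric] sum.lessThan_Suc_shift by simp
  also have "[\<dots> = fact (p - 1) ^ 2 * ((1 + 4 * z) ^ h - 1)] (mod int p)"
    by (intro cong_scalar_left cong_diff central_binomial_sum_cong[OF assms(1) h] cong_refl)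
  finally have "[R = (2 * x + 1) * (fact (p - 1) ^ 2 * ((1 + 4 * z) ^ h - 1))] (mod int p)"
    unfolding R_def by (rule cong_scalar_left)
  also have "1 + 4 * z = (2 * x + 1) ^ 2"
    unfolding z_def by (simp add: power2_eq_square algebra_simps)
  \<comment> \<open>The prefactor 2x + 1 raises the exponent 2h to p, so no case split on whether p
    divides 2x + 1 is required.\<close>
  also have "(2 * x + 1) * (fact (p - 1) ^ 2 * (((2 * x + 1) ^ 2) ^ h - 1))
      = fact (p - 1) ^ 2 * ((2 * x + 1) ^ p - (2 * x + 1))"
    unfolding h power_add power_mult power_one_right by (simp only: algebra_simps)
  also have "[\<dots> = 0] (mod int p)"
    using fermat_int[OF assms(1), of "2 * x + 1"] by (simp only: cong_iff_dvd_diff diff_zero dvd_mult)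
  finally obtain j where j: "R = int p * j"
    unfolding cong_0_iff by (elim dvdE)
  have pr: "prime (int p)" using assms(1) by simp
  have "\<not> int p dvd 2"
    using assms(2) h assms(1) prime_ge_2_nat[of p] by (auto dest!: zdvd_imp_le)
  moreover have "\<not> int p dvd fact (p - 1)"
    using assms(1) prime_gt_0_nat[of p] prime_dvd_fact_iff[of p "p - 1"]
    by (metis diff_less less_one not_le of_nat_dvd_iff of_nat_fact)
  ultimately have "\<not> int p dvd 2 * x * fact (p - 1) ^ 2"
    using assms(3) by (simp add: prime_dvd_mult_iff[OF pr] prime_dvd_power_iff[OF pr])
  moreover have "(\<Sum>n=1..p-1. D n x * S n x) * of_int (2 * x * fact (p - 1) ^ 2) = of_int (int p * j)"
    using eq unfolding j by (simp add: mult.commute)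
  ultimately show ?thesis
    by (intro rat_cong_0I)
qed

end
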